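(* Let $n\in\{4,5\}$ and let $R$ be an $n\times n$ rotation matrix. Define $$\delta=\tfrac12\mathrm{tr}(R^2)-\tfrac14\bigl(\mathrm{tr}(R)\bigr)^2+\tfrac12(n-4)\,\mathrm{tr}(R)-\tfrac14 n(n-6),$$ $$y_\pm=\tfrac14\bigl(\mathrm{tr}(R)-n+4\bigr)\pm\tfrac12\sqrt{\delta}.$$ Then $\delta\ge 0$ and $-1\le y_\pm\le 1$. Put $\theta_\pm=\cos^{-1}y_\pm\in[0,\pi]$. If $\delta\neq 0$ and neither $y_+$ nor $y_-$ belongs to $\{1,-1\}$, then $\exp(f)=R$, where $f$ is antisymmetric and has the orthogonal decomposition $f=f_++f_-$ with $$f_\pm=\mp\frac{\theta_\pm}{2\sin\theta_\pm\sqrt{\delta}}\Bigl(y_\mp(R-R^t)-\tfrac12\bigl(R^2-(R^2)^t\bigr)\Bigr).$$ If $\delta=0$ and $y_+\notin\{1,-1\}$, then $\exp(f)=R$ for the antisymmetric matrix $$f=\frac{\theta_+}{2\sin\theta_+}(R-R^t).$$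
   Context: A rotation matrix is a real orthogonal matrix of determinant $1$; $R^t$ is the transpose of $R$; $\exp(A)=\sum_{k\ge0}A^k/k!$. For ${\bf u},{\bf v}\in\mathbb{R}^n$, the outer product ${\bf u}\otimes{\bf v}$ is the linear map $({\bf u}\otimes{\bf v})({\bf w})=({\bf v}\cdot{\bf w}){\bf u}$, and the wedge product is the antisymmetric linear map (matrix) ${\bf u}\wedge{\bf v}={\bf u}\otimes{\bf v}-{\bf v}\otimes{\bf u}$. The two-plane of a nonzero wedge product ${\bf u}\wedge{\bf v}$ is the span of ${\bf u},{\bf v}$. An orthogonal decomposition of an antisymmetric matrix $f$ is an expression of $f$ as a sum of wedge products whose two-planes are mutually orthogonal (every vector of one is orthogonal to every vector of the other). Formulas with $\pm,\mp$ are read with all upper signs or all lower signs. *)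

theory Defs
  imports "HOL-Analysis.Analysis"
begin

text \<open>The type \<^typ>\<open>real^'n^'n\<close> carries a componentwise multiplication, so the overloaded \<open>^\<close> and
  \<^const>\<open>exp\<close> of the library do not give matrix powers and the matrix exponential.\<close>

primrec mat_pow :: "real^'n^'n \<Rightarrow> nat \<Rightarrow> real^'n^'n" where
  "mat_pow A 0 = mat 1"
| "mat_pow A (Suc k) = A ** mat_pow A k"

definition mat_exp :: "real^'n^'n \<Rightarrow> real^'n^'n" where
  "mat_exp A = (\<Sum>k. (1 / fact k) *\<^sub>R mat_pow A k)"

definition antisymmetric_matrix :: "real^'n^'n \<Rightarrow> bool" where
  "antisymmetric_matrix A \<longleftrightarrow> transpose A = - A"

definition outer :: "real^'n \<Rightarrow> real^'n \<Rightarrow> real^'n^'n" where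
  "outer u v = matrix (\<lambda>w. (v \<bullet> w) *\<^sub>R u)"

definition wedge :: "real^'n \<Rightarrow> real^'n \<Rightarrow> real^'n^'n" where
  "wedge u v = outer u v - outer v u"

text \<open>The plane of a nonzero wedge product is stated as a relation; it does not depend on the
  factors chosen, which are not unique. In particular \<open>two_plane_of w P\<close> forces \<open>w\<close> to be a
  nonzero wedge product.\<close>

definition two_plane_of :: "real^'n^'n \<Rightarrow> (real^'n) set \<Rightarrow> bool" where
  "two_plane_of w P \<longleftrightarrow> w \<noteq> 0 \<and> (\<exists>u v. w = wedge u v \<and> P = span {u, v})"

text \<open>The second argument lists the summands of the decomposition.\<close>

definition orthogonal_decomposition :: "real^'n^'n \<Rightarrow> (real^'n^'n) list \<Rightarrow> bool" where
  "orthogonal_decomposition f ws \<longleftrightarrow>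
     f = sum_list ws \<and>
     (\<exists>Ps. list_all2 two_plane_of ws Ps \<and>
           sorted_wrt (\<lambda>P Q. \<forall>p\<in>P. \<forall>q\<in>Q. orthogonal p q) Ps)"

lemma outer_mult_vec: "outer u v *v w = (v \<bullet> w) *\<^sub>R u"
proof -
  have "linear (\<lambda>w. (v \<bullet> w) *\<^sub>R u)"
    by (rule linearI) (simp_all add: inner_add_right scaleR_add_left)
  then show ?thesis
    unfolding outer_def by (simp only: matrix_works linear_matrix_vector_mul_eq)
qed

lemma onorm_mat_pow_le:
  fixes A :: "real^'n^'n"
  shows "onorm ((*v) (mat_pow A k)) \<le> onorm ((*v) A) ^ k"
proof (induction k)
  case 0
  have "onorm ((*v) (mat 1 :: real^'n^'n)) \<le> 1"
    by (rule onorm_bound) simp_all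
  then show ?case unfolding mat_pow.simps power_0 .
next
  case (Suc k)
  have "(*v) (mat_pow A (Suc k)) = (*v) A \<circ> (*v) (mat_pow A k)"
    by (rule ext) (simp add: matrix_vector_mul_assoc)
  moreover have "onorm ((*v) A \<circ> (*v) (mat_pow A k)) \<le> onorm ((*v) A) * onorm ((*v) (mat_pow A k))"
    by (rule onorm_compose) (rule matrix_vector_mul_bounded_linear)+
  ultimately have "onorm ((*v) (mat_pow A (Suc k))) \<le> onorm ((*v) A) * onorm ((*v) (mat_pow A k))"
    by simp
  also have "\<dots> \<le> onorm ((*v) A) * onorm ((*v) A) ^ k"
    by (intro mult_left_mono Suc.IH onorm_pos_le matrix_vector_mul_bounded_linear)
  finally show ?case by simp
qed

lemma norm_matrix_le_onorm:
  fixes A :: "real^'n^'n"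
  shows "norm A \<le> (real CARD('n) * real CARD('n)) * onorm ((*v) A)"
proof -
  have "norm A \<le> (\<Sum>i\<in>UNIV. norm (A $ i))"
    unfolding norm_vec_def by (rule L2_set_le_sum) simp
  also have "\<dots> \<le> (\<Sum>i\<in>UNIV. \<Sum>j\<in>UNIV. \<bar>A $ i $ j\<bar>)"
    by (intro sum_mono norm_le_l1_cart)
  also have "\<dots> \<le> (\<Sum>i\<in>(UNIV::'n set). \<Sum>j\<in>(UNIV::'n set). onorm ((*v) A))"
    by (intro sum_mono matrix_component_le_onorm)
  finally show ?thesis by (simp add: mult.assoc)
qed

lemma mat_exp_sums:
  fixes A :: "real^'n^'n"
  shows "(\<lambda>k. (1 / fact k) *\<^sub>R mat_pow A k) sums mat_exp A"
proof -
  let ?K = "onorm ((*v) A)" and ?C = "real CARD('n) * real CARD('n)"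
  have "summable (\<lambda>k. ?C * (inverse (fact k) * ?K ^ k))"
    by (intro summable_mult summable_exp)
  moreover have "norm ((1 / fact k) *\<^sub>R mat_pow A k) \<le> ?C * (inverse (fact k) * ?K ^ k)" for k
  proof -
    have "norm (mat_pow A k) \<le> ?C * ?K ^ k"
      by (rule order_trans[OF norm_matrix_le_onorm])
        (intro mult_left_mono onorm_mat_pow_le, simp)
    then have "inverse (fact k) * norm (mat_pow A k) \<le> inverse (fact k) * (?C * ?K ^ k)"
      by (intro mult_left_mono) auto
    then show ?thesis by (simp add: inverse_eq_divide mult_ac)
  qed
  ultimately have "summable (\<lambda>k. (1 / fact k) *\<^sub>R mat_pow A k)"
    by (rule summable_comparison_test'[where N = 0])
  then show ?thesis
    unfolding mat_exp_def by (rule summable_sums)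
qed

end

theory Submission
  imports Defs
begin

text \<open>In a suitable orthonormal basis a rotation \<open>R\<close> of dimension \<open>4\<close> or \<open>5\<close> rotates two mutually
orthogonal planes by angles \<open>t \<le> t'\<close> in \<open>[0, \<pi>]\<close> and fixes the remaining vector, if there is one
(\<open>rotation_two_plane_form\<close>). Everything else is read off from this form. Computing the traces of
\<open>R\<close> and \<open>R\<^sup>2\<close> in the basis gives \<open>\<delta> = (cos t - cos t')\<^sup>2\<close>, hence \<open>y\<^sub>+ = cos t\<close>, \<open>y\<^sub>- = cos t'\<close>,
\<open>\<theta>\<^sub>+ = t\<close> and \<open>\<theta>\<^sub>- = t'\<close>. On a plane rotated by \<open>t\<close> the matrices \<open>R - R\<^sup>T\<close> and \<open>R\<^sup>2 - (R\<^sup>2)\<^sup>T\<close> are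
multiples of the quarter turn (\<open>rotates_plane_skew_part\<close>); the coefficients in \<open>f\<^sub>\<plusminus>\<close> are such that
\<open>f\<^sub>+\<close> is \<open>t\<close> times the quarter turn of the first plane and zero on its complement, and \<open>f\<^sub>-\<close> likewise
for the second plane. Thus \<open>f\<^sub>\<plusminus>\<close> are wedge products with orthogonal planes, and
\<open>exp (f\<^sub>+ + f\<^sub>-)\<close> rotates the planes by the same angles as \<open>R\<close> (\<open>mat_exp_rotates_plane\<close>). For
\<open>\<delta> = 0\<close> the angles agree and \<open>R - R\<^sup>T\<close> is the same multiple of the quarter turn on both planes.

The normal form is built from the eigenvectors of the symmetric matrix \<open>R + R\<^sup>T\<close>. Such an
eigenvector \<open>x\<close> spans together with \<open>R x\<close> an \<open>R\<close>-invariant subspace of dimension at most two. The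
difficulty is dimension one, \<open>R x = \<plusminus> x\<close>: then a second eigenvector of the same sign has to be
found, and this is where \<open>det R = 1\<close> enters. The determinant forces eigenvalues \<open>1\<close> or \<open>-1\<close> by
parity (\<open>sign_eigenvector_exists\<close>), and composing with reflections transports this to the
complement of the eigenvectors already found (\<open>sign_eigenvector_outside\<close>). The notion of a
balanced frame records the parities, so that the planes can be split off one after another
(\<open>balanced_frame_extend\<close>).\<close>

section \<open>Eigenvectors of symmetric matrices\<close>

lemma inner_mult_vec_left:
  fixes A :: "real^'n^'n"
  shows "(A *v x) \<bullet> y = x \<bullet> (transpose A *v y)"
  by (metis dot_lmul_matrix inner_commute vector_transpose_matrix)

lemma orthogonal_matrix_inner:
  fixes R :: "real^'n^'n"
  assumes "orthogonal_matrix R"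
  shows "(R *v x) \<bullet> (R *v y) = x \<bullet> y"
  using assms by (simp add: inner_mult_vec_left matrix_vector_mul_assoc orthogonal_matrix)

text \<open>The quadratic form \<open>x \<bullet> (M *v x)\<close> attains its maximum on the unit sphere of the invariant
subspace, and a maximum point is an eigenvector: the first variation of the Rayleigh quotient in
the direction of the residual vector \<open>M *v x - c *\<^sub>R x\<close> is twice the squared norm of that vector.\<close>

lemma symmetric_eigenvector_in_subspace:
  fixes M :: "real^'n^'n"
  assumes sym: "transpose M = M" and V: "subspace V" and nz: "V \<noteq> {0}"
    and inv: "\<And>x. x \<in> V \<Longrightarrow> M *v x \<in> V"
  obtains x c where "x \<in> V" "norm x = 1" "M *v x = c *\<^sub>R x"
proof -
  define K where "K = sphere 0 1 \<inter> V"
  have "compact K" unfolding K_def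
    by (intro compact_Int_closed compact_sphere closed_subspace V)
  moreover have "K \<noteq> {}"
  proof -
    obtain z where z: "z \<in> V" "z \<noteq> 0" using nz subspace_0[OF V] by auto
    then have "z /\<^sub>R norm z \<in> K" using subspace_mul[OF V] by (simp add: K_def)
    then show ?thesis by auto
  qed
  moreover have "continuous_on K (\<lambda>x. x \<bullet> (M *v x))"
    by (intro continuous_intros matrix_vector_mult_linear_continuous_on)
  ultimately obtain x where x: "x \<in> K" and max: "\<And>y. y \<in> K \<Longrightarrow> y \<bullet> (M *v y) \<le> x \<bullet> (M *v x)"
    using continuous_attains_sup by metis
  define c where "c = x \<bullet> (M *v x)"
  have xV: "x \<in> V" and nx: "x \<bullet> x = 1" "norm x = 1"
    using x by (auto simp: K_def norm_eq_1)
  have le: "z \<bullet> (M *v z) \<le> c * (z \<bullet> z)" if "z \<in> V" for z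
  proof (cases "z = 0")
    case False
    then have "z /\<^sub>R norm z \<in> K" using that subspace_mul[OF V] by (simp add: K_def)
    from max[OF this] have "(z \<bullet> (M *v z)) / (norm z)\<^sup>2 \<le> c"
      by (simp add: c_def matrix_vector_mult_scaleR power2_eq_square divide_inverse mult_ac)
    then show ?thesis using False by (simp add: divide_le_eq power2_norm_eq_inner)
  qed simp
  define w where "w = M *v x - c *\<^sub>R x"
  have wV: "w \<in> V" unfolding w_def by (intro subspace_diff subspace_mul V xV inv)
  have ortho: "x \<bullet> w = 0" by (simp add: w_def inner_diff_right c_def nx)
  have Mxw: "w \<bullet> (M *v x) = w \<bullet> w" "x \<bullet> (M *v w) = w \<bullet> w"
  proof -
    show 1: "w \<bullet> (M *v x) = w \<bullet> w"
      using ortho by (simp add: w_def inner_diff_right inner_commute)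
    show "x \<bullet> (M *v w) = w \<bullet> w"
      using 1 inner_mult_vec_left[of M x w] sym by (simp add: inner_commute)
  qed
  \<comment> \<open>maximality of \<open>x\<close>, tested at \<open>x + t *\<^sub>R w\<close>: a linear term in \<open>t\<close> is dominated by a quadratic one\<close>
  have quad: "2 * (w \<bullet> w) * t \<le> (c * (w \<bullet> w) - w \<bullet> (M *v w)) * t\<^sup>2" for t
  proof -
    have "x + t *\<^sub>R w \<in> V" by (intro subspace_add subspace_mul V xV wV)
    from le[OF this] show ?thesis
      by (simp add: matrix_vector_right_distrib matrix_vector_mult_scaleR inner_add_left inner_add_right
          Mxw ortho nx inner_commute[of w x] c_def[symmetric] power2_eq_square algebra_simps)
  qed
  have "w \<bullet> w = 0"
  proof (rule ccontr)
    define p where "p = w \<bullet> w"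
    define q where "q = c * p - w \<bullet> (M *v w)"
    assume "w \<bullet> w \<noteq> 0"
    then have p: "p > 0" by (simp add: p_def)
    have q: "2 * p * t \<le> q * t\<^sup>2" for t using quad[of t] by (simp add: p_def q_def)
    have q0: "q > 0" using q[of 1] p by simp
    \<comment> \<open>the choice \<open>t = p / q\<close> minimizes \<open>q * t\<^sup>2 - 2 * p * t\<close>\<close>
    have "2 * p * (p / q) \<le> q * (p/q)\<^sup>2" by (rule q)
    also have "\<dots> = p * (p / q)" using q0 by (simp add: power2_eq_square)
    finally show False using p q0 by (simp add: divide_simps)
  qed
  then have "M *v x = c *\<^sub>R x" by (simp add: w_def)
  with xV nx that show thesis by blast
qed

section \<open>Orthonormal sets and reflections\<close>

lemma orthonormal_independent:
  fixes B :: "(real^'n) set"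
  assumes "pairwise orthogonal B" "\<And>b. b \<in> B \<Longrightarrow> norm b = 1"
  shows "finite B" "independent B"
proof -
  show "independent B" using assms by (intro pairwise_orthogonal_independent) force+
  then show "finite B" by (rule finiteI_independent)
qed

lemma orthonormal_card_span:
  fixes B :: "(real^'n) set"
  assumes "pairwise orthogonal B" "\<And>b. b \<in> B \<Longrightarrow> norm b = 1" "card B = CARD('n)"
  shows "span B = UNIV"
  using orthonormal_independent[of B] assms 
  by (simp add: dim_eq_full[symmetric] dim_eq_card_independent)

lemma orthogonal_complement_nontrivial:
  fixes B :: "(real^'n) set"
  assumes "pairwise orthogonal B" "\<And>b. b \<in> B \<Longrightarrow> norm b = 1" "card B < CARD('n)"
  shows "{x. \<forall>b\<in>B. orthogonal b x} \<noteq> {0}"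
proof -
  have "dim B < DIM(real^'n)"
    using orthonormal_independent[of B] assms by (simp add: dim_eq_card_independent)
  then obtain x where "x \<noteq> 0" "\<And>y. y \<in> span B \<Longrightarrow> orthogonal x y"
    using orthogonal_to_subspace_exists by blast
  then show ?thesis by (auto simp: orthogonal_commute span_base)
qed

text \<open>The reflection in the hyperplane orthogonal to \<open>x\<close> is conjugate, by an orthogonal matrix, to the
diagonal matrix that negates a single coordinate; this gives its determinant.\<close>

lemma householder_exists:
  fixes x :: "real^'n"
  assumes x: "norm x = 1"
  obtains H :: "real^'n^'n" where "orthogonal_matrix H" "det H = -1"
    "H *v x = - x" "\<And>y. orthogonal x y \<Longrightarrow> H *v y = y"
proof -
  \<comment> \<open>any coordinate direction serves as the reference vector\<close>
  define k :: 'n where "k = undefined"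
  obtain Q where Q: "orthogonal_matrix Q" and Qk: "Q *v axis k 1 = x"
    using orthogonal_matrix_exists_basis[OF x] by metis
  define D :: "real^'n^'n" where "D = (\<chi> i j. if i = j then (if i = k then -1 else 1) else 0)"
  have DD: "D *v z = z - (2 * z $ k) *\<^sub>R axis k 1" for z
  proof (subst vec_eq_iff, rule allI)
    fix i
    have "D $ i $ j * z $ j = (if j = i then (if i = k then -1 else 1) * z $ j else 0)" for j
      by (simp add: D_def)
    then have "(D *v z) $ i = (\<Sum>j\<in>UNIV. if j = i then (if i = k then -1 else 1) * z $ j else 0)"
      unfolding matrix_vector_mult_def by simp
    also have "\<dots> = (if i = k then -1 else 1) * z $ i"
      by (subst sum.delta) auto
    finally show "(D *v z) $ i = (z - (2 * z $ k) *\<^sub>R axis k 1) $ i" by (simp add: axis_def)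
  qed
  have tD: "transpose D = D" by (simp add: D_def transpose_def vec_eq_iff)
  have D2: "D ** D = mat 1"
    unfolding matrix_eq by (auto simp: DD matrix_vector_mul_assoc[symmetric] axis_def vec_eq_iff)
  have "det D = (\<Prod>i\<in>UNIV. D $ i $ i)" by (rule det_diagonal) (simp add: D_def)
  also have "\<dots> = -1" by (simp add: D_def prod.If_cases Int_def)
  finally have dD: "det D = -1" .
  let ?H = "Q ** D ** transpose Q"
  have Qt: "transpose Q ** Q = mat 1" "Q ** transpose Q = mat 1" using Q by (auto simp: orthogonal_matrix_def)
  show thesis
  proof
    have "orthogonal_matrix D" using tD D2 by (simp add: orthogonal_matrix)
    then show "orthogonal_matrix ?H"
      using Q by (intro orthogonal_matrix_mul) (simp_all add: orthogonal_matrix_transpose)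
    show "det ?H = -1"
    proof -
      have "det Q * det (transpose Q) = 1" using Qt(2) det_mul[of Q "transpose Q"] by simp
      then show ?thesis by (simp add: det_mul dD)
    qed
    have Hz: "?H *v z = z - (2 * (x \<bullet> z)) *\<^sub>R x" for z
    proof -
      have "(transpose Q *v z) $ k = x \<bullet> z"
        using inner_mult_vec_left[of Q "axis k 1" z] by (simp add: Qk inner_axis')
      moreover have "Q *v (transpose Q *v z) = z"
        by (simp only: matrix_vector_mul_assoc Qt matrix_vector_mul_lid)
      ultimately show ?thesis
        by (simp add: matrix_vector_mul_assoc[symmetric] DD matrix_vector_mult_diff_distrib matrix_vector_mult_scaleR Qk)
    qed
    show "?H *v x = - x" using x by (simp add: Hz norm_eq_1 scaleR_2)
    show "?H *v y = y" if "orthogonal x y" for y using that by (simp add: Hz orthogonal_def)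
  qed
qed

text \<open>A product of commuting reflections. Composing with it flips the determinant once per vector and
changes nothing on the orthogonal complement, so that determinant criteria for eigenvalues can be
applied to the complement of known eigenvectors without restricting the matrix to a subspace.\<close>

lemma negate_orthonormal_exists:
  fixes X :: "(real^'n) set"
  assumes "finite X" "pairwise orthogonal X" "\<And>x. x \<in> X \<Longrightarrow> norm x = 1"
  shows "\<exists>H :: real^'n^'n. orthogonal_matrix H \<and> det H = (-1) ^ card X \<and>
    (\<forall>x\<in>X. H *v x = - x) \<and> (\<forall>y. (\<forall>x\<in>X. orthogonal x y) \<longrightarrow> H *v y = y)"
  using assms
proof (induction X rule: finite_induct)
  case empty
  show ?case by (rule exI[of _ "mat 1"]) (simp add: orthogonal_matrix_id)
next
  case (insert x X)
  have ox: "orthogonal y x" "orthogonal x y" if "y \<in> X" for y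
    using insert.prems(1) insert.hyps(2) that by (auto simp: pairwise_def orthogonal_commute)
  have pX: "pairwise orthogonal X" using insert.prems(1) by (auto simp: pairwise_def)
  obtain H where H: "orthogonal_matrix H" "det H = (-1) ^ card X"
    "\<And>x. x \<in> X \<Longrightarrow> H *v x = - x" "\<And>y. (\<forall>x\<in>X. orthogonal x y) \<Longrightarrow> H *v y = y"
    using insert.IH[OF pX] insert.prems(2) by blast
  obtain G :: "real^'n^'n" where G: "orthogonal_matrix G" "det G = -1" "G *v x = - x" "\<And>y. orthogonal x y \<Longrightarrow> G *v y = y"
    using householder_exists[of x] insert.prems(2) by blast
  have neg: "H *v (- z) = - (H *v z)" for z using matrix_vector_mult_scaleR[of H "-1" z] by simp
  show ?case
  proof (intro exI[of _ "H ** G"] conjI ballI allI impI)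
    show "orthogonal_matrix (H ** G)" using H G by (simp add: orthogonal_matrix_mul)
    show "det (H ** G) = (-1) ^ card (insert x X)" using H G insert.hyps by (simp add: det_mul)
    show "H ** G *v z = - z" if "z \<in> insert x X" for z
      using that H G ox by (auto simp: matrix_vector_mul_assoc[symmetric] neg)
    show "H ** G *v z = z" if "\<forall>y\<in>insert x X. orthogonal y z" for z
      using that H G by (auto simp: matrix_vector_mul_assoc[symmetric])
  qed
qed

section \<open>Eigenvalues 1 and -1 of orthogonal matrices\<close>

text \<open>The determinant criterion: for \<open>s = 1\<close> or \<open>s = -1\<close> the orthogonality relation gives
\<open>M - s = M (- s (M - s)\<^sup>T)\<close>, hence \<open>det (M - s) = det M (- s)\<^sup>n det (M - s)\<close>, and under the
hypothesis the determinant equals its own negative.\<close>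

lemma sign_eigenvector_exists:
  fixes M :: "real^'n^'n"
  assumes M: "orthogonal_matrix M" and s: "s * s = 1" and d: "det M * (- s) ^ CARD('n) = -1"
  obtains y where "norm y = 1" "M *v y = s *\<^sub>R y"
proof -
  have dets: "det (r *\<^sub>R A) = r ^ CARD('n) * det A" for r and A :: "real^'n^'n"
  proof -
    have "r *\<^sub>R A = matrix (\<lambda>x. r *\<^sub>R x) ** A"
      by (simp add: matrix_eq matrix_vector_mul_assoc[symmetric] scaleR_matrix_vector_assoc matrix_works)
    then show ?thesis by (simp add: det_mul)
  qed
  define N where "N = M - s *\<^sub>R mat 1"
  have "M ** ((- s) *\<^sub>R transpose N) = N"
  proof -
    have tN: "transpose N = transpose M - s *\<^sub>R mat 1"
      by (simp add: N_def transpose_def vec_eq_iff mat_def)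
    have "M ** ((- s) *\<^sub>R transpose N) = (- s) *\<^sub>R (M ** transpose M) + (s * s) *\<^sub>R M"
      unfolding matrix_eq tN
      by (simp add: matrix_vector_mul_assoc[symmetric] matrix_vector_mult_diff_rdistrib
        matrix_vector_mult_add_rdistrib scaleR_matrix_vector_assoc[symmetric]
        matrix_vector_mult_diff_distrib matrix_vector_mult_scaleR scaleR_diff_right)
    also have "\<dots> = N" using M s by (simp add: orthogonal_matrix_def N_def)
    finally show ?thesis .
  qed
  then have "det N = det M * ((-s) ^ CARD('n) * det N)"
    by (metis det_mul dets det_transpose)
  then have "det N = 0" using d by (simp add: mult.assoc[symmetric])
  then have "\<not> (\<exists>B. B ** N = mat 1)"
    using invertible_det_nz[of N] by (simp add: invertible_left_inverse)
  then obtain y where y: "N *v y = 0" "y \<noteq> 0" unfolding matrix_left_invertible_ker by blast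
  have "M *v y = s *\<^sub>R y" using y by (simp add: N_def matrix_vector_mult_diff_rdistrib scaleR_matrix_vector_assoc[symmetric])
  then have "M *v (y /\<^sub>R norm y) = s *\<^sub>R (y /\<^sub>R norm y)" by (simp add: matrix_vector_mult_scaleR)
  moreover have "norm (y /\<^sub>R norm y) = 1" using y by simp
  ultimately show thesis using that by blast
qed

text \<open>After composition of \<open>R\<close> with the reflections along \<open>X\<close>, the vectors of \<open>X\<close> have eigenvalue \<open>- s\<close>,
so an eigenvector for \<open>s\<close> of the composition is orthogonal to \<open>X\<close>, where both matrices agree.\<close>

lemma sign_eigenvector_outside:
  fixes R :: "real^'n^'n"
  assumes R: "orthogonal_matrix R" and s: "s * s = 1"
    and X: "pairwise orthogonal X" "\<And>x. x \<in> X \<Longrightarrow> norm x = 1" "\<And>x. x \<in> X \<Longrightarrow> R *v x = s *\<^sub>R x"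
    and d: "det R * (-1) ^ card X * (- s) ^ CARD('n) = -1"
  obtains y where "norm y = 1" "R *v y = s *\<^sub>R y" "\<And>x. x \<in> X \<Longrightarrow> orthogonal x y"
proof -
  have "finite X" using orthonormal_independent X(1,2) by blast
  then obtain H :: "real^'n^'n" where H: "orthogonal_matrix H" "det H = (-1) ^ card X"
    "\<And>x. x \<in> X \<Longrightarrow> H *v x = - x" "\<And>y. (\<forall>x\<in>X. orthogonal x y) \<Longrightarrow> H *v y = y"
    using negate_orthonormal_exists[of X] X by blast
  have RH: "orthogonal_matrix (R ** H)" using R H by (simp add: orthogonal_matrix_mul)
  have "det (R ** H) * (- s) ^ CARD('n) = -1" using d H by (simp add: det_mul)
  from sign_eigenvector_exists[OF RH s this]
  obtain y where y: "norm y = 1" "(R ** H) *v y = s *\<^sub>R y" by blast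
  have orth: "orthogonal x y" if "x \<in> X" for x
  proof -
    have "R *v (- x) = - s *\<^sub>R x"
      using X(3)[OF that] matrix_vector_mult_scaleR[of R "-1" x] by simp
    then have "(R ** H) *v x = - s *\<^sub>R x" by (simp add: matrix_vector_mul_assoc[symmetric] H that)
    then have "x \<bullet> y = - (s * s) * (x \<bullet> y)"
      using orthogonal_matrix_inner[OF RH, of x y] y by simp
    then show ?thesis using s by (simp add: orthogonal_def)
  qed
  then have "H *v y = y" using H(4) by blast
  then have "R *v y = s *\<^sub>R y" using y by (simp add: matrix_vector_mul_assoc[symmetric])
  with y orth that show thesis by blast
qed

lemma symmetric_part_eigenvectors_orthogonal:
  fixes R :: "real^'n^'n"
  assumes "(R + transpose R) *v x = p *\<^sub>R x" "(R + transpose R) *v y = q *\<^sub>R y" "p \<noteq> q"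
  shows "orthogonal x y"
proof -
  have t: "transpose (R + transpose R) = R + transpose R" by (simp add: transpose_def vec_eq_iff)
  have "p * (x \<bullet> y) = q * (x \<bullet> y)"
    using inner_mult_vec_left[of "R + transpose R" x y] assms unfolding t by simp
  then show ?thesis using assms by (simp add: orthogonal_def)
qed

text \<open>An orthogonal matrix preserves lengths, and \<open>x \<bullet> (R *v x)\<close> depends on the symmetric part alone; the
value \<open>s * (x \<bullet> x)\<close> is the case of equality in the Cauchy-Schwarz inequality. Thus the
eigenvectors of \<open>R\<close> for \<open>1\<close> and \<open>-1\<close> are seen by the symmetric part, whose eigenspaces are
orthogonal to each other.\<close>

lemma symmetric_part_sign_eigenvector:
  fixes R :: "real^'n^'n"
  assumes R: "orthogonal_matrix R" and s: "s * s = 1"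
  shows "R *v x = s *\<^sub>R x \<longleftrightarrow> (R + transpose R) *v x = (2 * s) *\<^sub>R x"
proof
  assume l: "R *v x = s *\<^sub>R x"
  have "transpose R *v (R *v x) = x"
    using R by (simp only: matrix_vector_mul_assoc orthogonal_matrix matrix_vector_mul_lid)
  then have "s *\<^sub>R (transpose R *v x) = x" by (simp only: l matrix_vector_mult_scaleR)
  then have "(s * s) *\<^sub>R (transpose R *v x) = s *\<^sub>R x" by (metis scaleR_scaleR)
  then have "transpose R *v x = s *\<^sub>R x" using s by (simp only: scaleR_one)
  then show "(R + transpose R) *v x = (2 * s) *\<^sub>R x"
    unfolding matrix_vector_mult_add_rdistrib l by (simp only: scaleR_add_left[symmetric] mult_2)
next
  assume r: "(R + transpose R) *v x = (2 * s) *\<^sub>R x"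
  have "x \<bullet> (transpose R *v x) = x \<bullet> (R *v x)"
    using inner_mult_vec_left[of R x x] by (simp only: inner_commute)
  then have "x \<bullet> (R *v x) = s * (x \<bullet> x)"
    using arg_cong[OF r, of "\<lambda>z. x \<bullet> z"] by (simp only: matrix_vector_mult_add_rdistrib inner_add_right inner_scaleR_right)
  then have "(R *v x - s *\<^sub>R x) \<bullet> (R *v x - s *\<^sub>R x) = (1 - s * s) * (x \<bullet> x)"
    using orthogonal_matrix_inner[OF R, of x x]
    by (simp add: inner_diff_left inner_diff_right inner_commute[of "R *v x" x] algebra_simps)
  then show "R *v x = s *\<^sub>R x" using s by simp
qed

section \<open>Rotated planes and adapted orthonormal frames\<close>

text \<open>Nothing is required of \<open>u\<close> and \<open>v\<close>, so the case \<open>t = 0\<close>, \<open>v = 0\<close> expresses that \<open>u\<close> is fixed.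
For \<open>t = pi\<close> the plane is negated.\<close>

definition rotates_plane :: "real^'n^'n \<Rightarrow> real \<Rightarrow> real^'n \<Rightarrow> real^'n \<Rightarrow> bool" where
  "rotates_plane R t u v \<longleftrightarrow>
     R *v u = cos t *\<^sub>R u + sin t *\<^sub>R v \<and> R *v v = cos t *\<^sub>R v - sin t *\<^sub>R u"

lemma rotates_plane_transpose:
  assumes R: "orthogonal_matrix R" and rot: "rotates_plane R t u v"
  shows "transpose R *v u = cos t *\<^sub>R u - sin t *\<^sub>R v"
    and "transpose R *v v = cos t *\<^sub>R v + sin t *\<^sub>R u"
proof -
  have inv: "transpose R *v (R *v x) = x" for x
    using R by (simp only: matrix_vector_mul_assoc orthogonal_matrix matrix_vector_mul_lid)
  have cs: "cos t * cos t + sin t * sin t = 1"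
    using sin_cos_squared_add3 by blast
  have "R *v (cos t *\<^sub>R u - sin t *\<^sub>R v) = (cos t * cos t + sin t * sin t) *\<^sub>R u"
    using rot unfolding rotates_plane_def
    by (simp add: matrix_vector_mult_diff_distrib matrix_vector_mult_scaleR scaleR_add_right scaleR_diff_right mult.commute)
      (simp only: scaleR_add_left[symmetric] cs scaleR_one)
  then show "transpose R *v u = cos t *\<^sub>R u - sin t *\<^sub>R v"
    using inv cs by (metis scaleR_one)
  have "R *v (cos t *\<^sub>R v + sin t *\<^sub>R u) = (cos t * cos t + sin t * sin t) *\<^sub>R v"
    using rot unfolding rotates_plane_def
    by (simp add: matrix_vector_right_distrib matrix_vector_mult_scaleR scaleR_add_right scaleR_diff_right mult.commute)
      (simp only: scaleR_add_left[symmetric] cs scaleR_one)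
  then show "transpose R *v v = cos t *\<^sub>R v + sin t *\<^sub>R u"
    using inv cs by (metis scaleR_one)
qed

text \<open>A rotated plane contributes to the eigenspace of \<open>s\<close> either both of its spanning vectors or
neither, which keeps the parity condition below intact.\<close>

lemma rotates_plane_sign_eigenvector:
  assumes uv: "norm u = 1" "norm v = 1" "orthogonal u v" and rot: "rotates_plane R t u v"
  shows "R *v u = s *\<^sub>R u \<longleftrightarrow> R *v v = s *\<^sub>R v"
proof -
  have i: "u \<bullet> u = 1" "v \<bullet> v = 1" "u \<bullet> v = 0" "v \<bullet> u = 0"
    using uv by (simp_all add: norm_eq_1 orthogonal_def inner_commute)
  have "sin t = 0 \<and> cos t = s" if "R *v u = s *\<^sub>R u"
    using rot arg_cong[OF that, of "\<lambda>z. v \<bullet> z"] arg_cong[OF that, of "\<lambda>z. u \<bullet> z"]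
    by (simp add: rotates_plane_def inner_add_right i)
  moreover have "sin t = 0 \<and> cos t = s" if "R *v v = s *\<^sub>R v"
    using rot arg_cong[OF that, of "\<lambda>z. v \<bullet> z"] arg_cong[OF that, of "\<lambda>z. u \<bullet> z"]
    by (simp add: rotates_plane_def inner_diff_right i)
  moreover have "R *v u = s *\<^sub>R u \<and> R *v v = s *\<^sub>R v" if "sin t = 0 \<and> cos t = s"
    using rot that by (simp add: rotates_plane_def)
  ultimately show ?thesis by blast
qed

text \<open>The invariant of the construction of an adapted basis. Its members are eigenvectors of the
symmetric part of \<open>R\<close> and the orthogonal complement is invariant under \<open>R\<close>. The last clause is a
parity condition: the number of members negated by \<open>R\<close> is even (\<open>s = -1\<close>), and the number of
members fixed by \<open>R\<close> has the parity of the dimension (\<open>s = 1\<close>). For \<open>det R = 1\<close> it forces a further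
eigenvector for \<open>s\<close> in the complement to come with a second one.\<close>

definition balanced_frame :: "real^'n^'n \<Rightarrow> (real^'n) set \<Rightarrow> bool" where
  "balanced_frame R B \<longleftrightarrow>
     pairwise orthogonal B \<and> (\<forall>b\<in>B. norm b = 1) \<and>
     (\<forall>b\<in>B. \<exists>c. (R + transpose R) *v b = c *\<^sub>R b) \<and>
     (\<forall>x. (\<forall>b\<in>B. orthogonal b x) \<longrightarrow> (\<forall>b\<in>B. orthogonal b (R *v x))) \<and>
     (\<forall>s. s * s = 1 \<longrightarrow> (-1) ^ card {b\<in>B. R *v b = s *\<^sub>R b} * (- s) ^ CARD('n) = 1)"

lemma balanced_frame_insert_pair:
  fixes R :: "real^'n^'n"
  assumes R: "orthogonal_matrix R" and B: "balanced_frame R B"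
    and uv: "norm u = 1" "norm v = 1" "orthogonal u v"
    and uB: "\<forall>b\<in>B. orthogonal b u" and vB: "\<forall>b\<in>B. orthogonal b v"
    and rot: "rotates_plane R t u v"
  shows "balanced_frame R (insert u (insert v B))" "card (insert u (insert v B)) = card B + 2"
proof -
  let ?C = "insert u (insert v B)"
  have fB: "finite B" using B orthonormal_independent unfolding balanced_frame_def by blast
  have nB: "\<And>b. b \<in> B \<Longrightarrow> norm b = 1"
    and eB: "\<And>b. b \<in> B \<Longrightarrow> \<exists>c. (R + transpose R) *v b = c *\<^sub>R b"
    and RB: "\<And>x. \<forall>b\<in>B. orthogonal b x \<Longrightarrow> \<forall>b\<in>B. orthogonal b (R *v x)"
    and parity: "\<And>s. s * s = 1 \<Longrightarrow> (-1) ^ card {b\<in>B. R *v b = s *\<^sub>R b} * (- s) ^ CARD('n) = 1"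
    using B unfolding balanced_frame_def by simp_all
  have ne: "u \<noteq> v" "u \<notin> B" "v \<notin> B"
    using uv uB vB by (auto simp: orthogonal_self)
  show "card ?C = card B + 2" using fB ne by simp
  have 1: "pairwise orthogonal ?C"
  proof -
    have "\<forall>b\<in>B. orthogonal u b" "\<forall>b\<in>B. orthogonal v b" "orthogonal v u"
      using uB vB uv by (simp_all add: orthogonal_commute)
    moreover have "pairwise orthogonal B" using B by (simp add: balanced_frame_def)
    ultimately show ?thesis using uv uB vB by (auto simp: pairwise_insert)
  qed
  have 2: "\<forall>b\<in>?C. \<exists>c. (R + transpose R) *v b = c *\<^sub>R b"
  proof -
    have "(R + transpose R) *v u = (2 * cos t) *\<^sub>R u" "(R + transpose R) *v v = (2 * cos t) *\<^sub>R v"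
      using rot unfolding matrix_vector_mult_add_rdistrib rotates_plane_transpose[OF R rot] rotates_plane_def mult_2 scaleR_add_left
      by (elim conjE, simp only:, simp)+
    then show ?thesis using eB by (auto simp del: matrix_vector_mult_add_rdistrib)
  qed
  have 3: "\<forall>b\<in>?C. orthogonal b (R *v x)" if x: "\<forall>b\<in>?C. orthogonal b x" for x
  proof -
    have "x \<bullet> (transpose R *v u) = 0" "x \<bullet> (transpose R *v v) = 0"
      using x unfolding rotates_plane_transpose[OF R rot]
      by (simp_all add: inner_diff_right inner_add_right orthogonal_def inner_commute[of x])
    then have "orthogonal u (R *v x)" "orthogonal v (R *v x)"
      using inner_mult_vec_left[of R x] by (simp_all only: orthogonal_def inner_commute[of _ "R *v x"])
    then show ?thesis using RB[of x] x by simp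
  qed
  have 4: "(-1::real) ^ card {b\<in>?C. R *v b = s *\<^sub>R b} = (-1) ^ card {b\<in>B. R *v b = s *\<^sub>R b}" for s
  proof (cases "R *v u = s *\<^sub>R u")
    case True
    then have "R *v v = s *\<^sub>R v" using rotates_plane_sign_eigenvector[OF uv rot] by blast
    then have "{b\<in>?C. R *v b = s *\<^sub>R b} = insert u (insert v {b\<in>B. R *v b = s *\<^sub>R b})"
      using True by auto
    then show ?thesis using fB ne by simp
  next
    case False
    then have "R *v v \<noteq> s *\<^sub>R v" using rotates_plane_sign_eigenvector[OF uv rot] by blast
    then have "{b\<in>?C. R *v b = s *\<^sub>R b} = {b\<in>B. R *v b = s *\<^sub>R b}"
      using False by auto
    then show ?thesis by simp
  qed
  have 5: "\<forall>b\<in>?C. norm b = 1" using uv nB by blast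
  have 6: "(-1::real) ^ card {b\<in>?C. R *v b = s *\<^sub>R b} * (- s) ^ CARD('n) = 1" if "s * s = 1" for s
    unfolding 4 using parity[OF that] .
  show "balanced_frame R ?C"
    unfolding balanced_frame_def by (intro conjI 1 2 5 allI impI 3 6)
qed

text \<open>Let \<open>x\<close> be an eigenvector of the symmetric part in the complement of the frame. If \<open>x\<close> is not an
eigenvector of \<open>R\<close>, then \<open>x\<close> and \<open>R *v x\<close> span a plane that \<open>R\<close> rotates, because
\<open>R (R x) = 2 c (R x) - x\<close> with \<open>c = x \<bullet> R x\<close>. If \<open>R *v x = s *\<^sub>R x\<close>, the parity condition supplies
a second such eigenvector, and the plane is rotated by the angle \<open>0\<close> or \<open>pi\<close>.\<close>

lemma balanced_frame_extend:
  fixes R :: "real^'n^'n"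
  assumes R: "rotation_matrix R" and B: "balanced_frame R B" and card: "card B < CARD('n)"
  obtains u v t where "0 \<le> t" "t \<le> pi" "norm u = 1" "norm v = 1" "orthogonal u v"
    "\<forall>b\<in>B. orthogonal b u" "\<forall>b\<in>B. orthogonal b v" "rotates_plane R t u v"
proof -
  have oR: "orthogonal_matrix R" and dR: "det R = 1" using R by (auto simp: rotation_matrix_def)
  let ?S = "R + transpose R"
  let ?V = "{x. \<forall>b\<in>B. orthogonal b x}"
  have pB: "pairwise orthogonal B" and nB: "\<And>b. b \<in> B \<Longrightarrow> norm b = 1"
    and eB: "\<And>b. b \<in> B \<Longrightarrow> \<exists>c. ?S *v b = c *\<^sub>R b"
    and RB: "\<And>x. \<forall>b\<in>B. orthogonal b x \<Longrightarrow> \<forall>b\<in>B. orthogonal b (R *v x)"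
    and parity: "\<And>s::real. s * s = 1 \<Longrightarrow> (-1) ^ card {b\<in>B. R *v b = s *\<^sub>R b} * (- s) ^ CARD('n) = 1"
    using B unfolding balanced_frame_def by simp_all
  have fB: "finite B" using orthonormal_independent pB nB by blast
  have sym: "transpose ?S = ?S" by (simp add: transpose_def vec_eq_iff)
  have "?S *v x \<in> ?V" if "x \<in> ?V" for x
  proof (clarify)
    fix b assume b: "b \<in> B"
    obtain c where c: "?S *v b = c *\<^sub>R b" using eB b by blast
    have "b \<bullet> (?S *v x) = (?S *v b) \<bullet> x" using inner_mult_vec_left[of ?S b x] by (simp only: sym)
    then show "orthogonal b (?S *v x)" using that b by (simp add: c orthogonal_def)
  qed
  moreover have "subspace ?V"
    by (auto simp: subspace_def orthogonal_clauses)
  moreover have "?V \<noteq> {0}" using orthogonal_complement_nontrivial pB nB card by blast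
  ultimately obtain x c0 where xV: "x \<in> ?V" and nx: "norm x = 1" and Sx: "?S *v x = c0 *\<^sub>R x"
    using symmetric_eigenvector_in_subspace[OF sym, of ?V] by blast
  have xx: "x \<bullet> x = 1" using nx by (simp add: norm_eq_1)
  show thesis
  proof (cases "\<exists>s::real. s * s = 1 \<and> R *v x = s *\<^sub>R x")
    case True
    then obtain s :: real where s: "s * s = 1" and Rx: "R *v x = s *\<^sub>R x" by blast
    \<comment> \<open>collecting all known eigenvectors for \<open>s\<close> makes their number have the parity
      that produces another one\<close>
    define X where "X = insert x {b\<in>B. R *v b = s *\<^sub>R b}"
    have "x \<notin> B" using xV nx by (auto simp: orthogonal_self)
    then have "card X = Suc (card {b\<in>B. R *v b = s *\<^sub>R b})" using fB by (simp add: X_def)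
    then have dX: "det R * (-1) ^ card X * (- s) ^ CARD('n) = -1" using parity[OF s] dR by simp
    have pX: "pairwise orthogonal X"
      using pB xV unfolding X_def by (auto simp: pairwise_def orthogonal_commute)
    have nX: "norm z = 1" if "z \<in> X" for z using that nx nB unfolding X_def by blast
    have eX: "R *v z = s *\<^sub>R z" if "z \<in> X" for z using that Rx unfolding X_def by blast
    obtain y where y: "norm y = 1" "R *v y = s *\<^sub>R y" and yX: "\<And>z. z \<in> X \<Longrightarrow> orthogonal z y"
      using sign_eigenvector_outside[OF oR s pX nX eX dX] by blast
    \<comment> \<open>the other members belong to different eigenvalues of the symmetric part\<close>
    have yB: "orthogonal b y" if b: "b \<in> B" for b
    proof (cases "R *v b = s *\<^sub>R b")
      case True
      then show ?thesis using b yX by (simp add: X_def)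
    next
      case False
      obtain c where c: "?S *v b = c *\<^sub>R b" using eB b by blast
      then have "c \<noteq> 2 * s" using False symmetric_part_sign_eigenvector[OF oR s] by blast
      then show ?thesis
        using symmetric_part_eigenvectors_orthogonal[OF c] y(2) symmetric_part_sign_eigenvector[OF oR s] by blast
    qed
    have "s = 1 \<or> s = -1" using s by (simp add: square_eq_1_iff)
    then obtain t where t: "0 \<le> t" "t \<le> pi" "cos t = s" "sin t = 0"
      by (metis cos_pi cos_zero order_refl pi_ge_zero sin_pi sin_zero)
    have "rotates_plane R t x y" using Rx y t by (simp add: rotates_plane_def)
    then show thesis using that[of t x y] t nx y xV yX yB by (simp add: X_def)
  next
    case False
    define c where "c = x \<bullet> (R *v x)"
    have RxRx: "(R *v x) \<bullet> (R *v x) = 1" using orthogonal_matrix_inner[OF oR] xx by simp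
    have "x \<bullet> (transpose R *v x) = c"
      using inner_mult_vec_left[of R x x] by (simp only: inner_commute c_def)
    then have "c0 = 2 * c"
      using arg_cong[OF Sx, of "\<lambda>z. x \<bullet> z"] by (simp only: matrix_vector_mult_add_rdistrib inner_add_right inner_scaleR_right xx c_def)
    have Tx: "transpose R *v x = (2 * c) *\<^sub>R x - R *v x"
      using Sx \<open>c0 = 2 * c\<close> by (metis add_diff_cancel_left' matrix_vector_mult_add_rdistrib)
    define w where "w = R *v x - c *\<^sub>R x"
    have xw: "x \<bullet> w = 0" by (simp add: w_def inner_diff_right c_def xx)
    have ww: "w \<bullet> w = 1 - c\<^sup>2"
      by (simp add: w_def inner_diff_right inner_diff_left xx RxRx c_def[symmetric] inner_commute[of "R *v x" x] power2_eq_square)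
    have "w \<noteq> 0"
    proof
      assume "w = 0"
      then have "c * c = 1" "R *v x = c *\<^sub>R x" using ww by (auto simp: w_def power2_eq_square)
      then show False using False by blast
    qed
    then have pos: "1 - c\<^sup>2 > 0" using ww by (metis inner_gt_zero_iff)
    then have c1: "-1 \<le> c" "c \<le> 1" by (simp_all add: abs_square_less_1 abs_less_iff)
    define t where "t = arccos c"
    have t: "0 \<le> t" "t \<le> pi" "cos t = c" "sin t = sqrt (1 - c\<^sup>2)"
      using c1 by (auto simp: t_def arccos_lbound arccos_ubound cos_arccos sin_arccos)
    define r where "r = sin t"
    have r: "r > 0" "r * r = 1 - c\<^sup>2" using pos by (auto simp: r_def t)
    define v where "v = (1 / r) *\<^sub>R w"
    have wv: "w = r *\<^sub>R v" using r by (simp add: v_def)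
    have "v \<bullet> v = 1" using ww r pos by (simp add: v_def)
    then have nv: "norm v = 1" by (simp add: norm_eq_1)
    have xv: "orthogonal x v" using xw by (simp add: orthogonal_def v_def)
    have vB: "\<forall>b\<in>B. orthogonal b v"
      using xV RB[of x] by (simp add: v_def w_def orthogonal_def inner_diff_right)
    have Rx: "R *v x = c *\<^sub>R x + r *\<^sub>R v" using wv by (simp add: w_def algebra_simps)
    have RRx: "R *v (R *v x) = (2 * c) *\<^sub>R (R *v x) - x"
    proof -
      have "R *v (transpose R *v x) = x"
        using oR by (simp only: matrix_vector_mul_assoc orthogonal_matrix_def matrix_vector_mul_lid)
      then show ?thesis unfolding Tx by (simp add: matrix_vector_mult_diff_distrib matrix_vector_mult_scaleR algebra_simps)
    qed
    have "R *v w = c *\<^sub>R (R *v x) - x"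
      unfolding w_def matrix_vector_mult_diff_distrib matrix_vector_mult_scaleR RRx mult_2 scaleR_add_left
      by simp
    also have "\<dots> = c *\<^sub>R r *\<^sub>R v - (r * r) *\<^sub>R x"
      unfolding Rx r(2) by (simp add: algebra_simps power2_eq_square)
    finally have "R *v v = (1 / r) *\<^sub>R (c *\<^sub>R r *\<^sub>R v - (r * r) *\<^sub>R x)"
      by (simp add: v_def matrix_vector_mult_scaleR)
    also have "\<dots> = c *\<^sub>R v - r *\<^sub>R x" using r(1) by (simp add: scaleR_diff_right)
    finally have "rotates_plane R t x v" using Rx by (simp add: rotates_plane_def t(3) r_def)
    then show thesis using that[of t x v] t nx nv xv xV vB by simp
  qed
qed

text \<open>In odd dimension a rotation has an axis, and one fixed vector gives the correct parity. In even
dimension the empty frame is balanced.\<close>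

lemma balanced_frame_start:
  fixes R :: "real^'n^'n"
  assumes R: "rotation_matrix R"
  obtains W where "balanced_frame R W" "card W = CARD('n) mod 2" "\<And>w. w \<in> W \<Longrightarrow> R *v w = w"
proof (cases "even CARD('n)")
  case True
  have "(- s) ^ CARD('n) = 1" if "s * s = 1" for s :: real
    using True that by (auto simp: square_eq_1_iff)
  then have "balanced_frame R {}" by (simp add: balanced_frame_def)
  then show thesis using that[of "{}"] True by simp
next
  case False
  have oR: "orthogonal_matrix R" and dR: "det R = 1" using R by (auto simp: rotation_matrix_def)
  obtain w where w: "norm w = 1" "R *v w = 1 *\<^sub>R w"
    using sign_eigenvector_exists[OF oR, of 1] dR False by auto
  have Sw: "(R + transpose R) *v w = 2 *\<^sub>R w"
    using symmetric_part_sign_eigenvector[OF oR, of 1 w] w by simp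
  have "orthogonal w (R *v x)" if "orthogonal w x" for x
    using orthogonal_matrix_inner[OF oR, of w x] that w by (simp add: orthogonal_def)
  moreover have "(-1) ^ card {b\<in>{w}. R *v b = s *\<^sub>R b} * (- s) ^ CARD('n) = 1" if "s * s = 1" for s :: real
  proof -
    have "w \<noteq> - w" using w by (auto simp: eq_neg_iff_add_eq_0 scaleR_2[symmetric])
    then show ?thesis
    using that False w by (auto simp: square_eq_1_iff Collect_conv_if)
  qed
  ultimately have "balanced_frame R {w}"
    using w Sw by (auto simp: balanced_frame_def)
  then show thesis using that[of "{w}"] False w by (simp add: odd_iff_mod_2_eq_one)
qed

section \<open>The normal form in dimensions 4 and 5\<close>

text \<open>The cardinality conditions say that \<open>u\<close>, \<open>v\<close>, \<open>u'\<close>, \<open>v'\<close> are distinct and not in \<open>W\<close>, so that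
together they form an orthonormal basis; \<open>W\<close> is empty in dimension \<open>4\<close> and contains the axis in
dimension \<open>5\<close>.\<close>

definition two_plane_form ::
  "real^'n^'n \<Rightarrow> (real^'n) set \<Rightarrow> real^'n \<Rightarrow> real^'n \<Rightarrow> real \<Rightarrow> real^'n \<Rightarrow> real^'n \<Rightarrow> real \<Rightarrow> bool" where
  "two_plane_form R W u v t u' v' t' \<longleftrightarrow>
     pairwise orthogonal ({u, v, u', v'} \<union> W) \<and> (\<forall>b\<in>{u, v, u', v'} \<union> W. norm b = 1) \<and>
     card W + 4 = CARD('n) \<and> card ({u, v, u', v'} \<union> W) = CARD('n) \<and>
     t \<in> {0..pi} \<and> rotates_plane R t u v \<and> t' \<in> {0..pi} \<and> rotates_plane R t' u' v' \<and>
     (\<forall>w\<in>W. R *v w = w)"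

lemma two_plane_form_swap:
  "two_plane_form R W u v t u' v' t' \<Longrightarrow> two_plane_form R W u' v' t' u v t"
proof -
  have "{u', v', u, v} = {u, v, u', v'}" by blast
  then show "two_plane_form R W u v t u' v' t' \<Longrightarrow> ?thesis"
    unfolding two_plane_form_def by simp
qed

text \<open>The two planes are ordered by angle, so that the first cosine is the larger one; this decides which
plane carries the upper sign in the formulas for \<open>y\<^sub>\<plusminus>\<close> and \<open>f\<^sub>\<plusminus>\<close>.\<close>

lemma rotation_two_plane_form:
  fixes R :: "real^'n^'n"
  assumes R: "rotation_matrix R" and n: "CARD('n) \<in> {4, 5}"
  obtains W u v t u' v' t' where "two_plane_form R W u v t u' v' t'" "t \<le> t'"
proof -
  have oR: "orthogonal_matrix R" using R by (auto simp: rotation_matrix_def)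
  obtain W where W: "balanced_frame R W" "card W = CARD('n) mod 2" "\<And>w. w \<in> W \<Longrightarrow> R *v w = w"
    using balanced_frame_start[OF R] by blast
  have cW: "card W + 4 = CARD('n)" using n W(2) by auto
  have less1: "card W < CARD('n)" using cW by simp
  obtain u v t where 1: "0 \<le> t" "t \<le> pi" "norm u = 1" "norm v = 1" "orthogonal u v"
      "\<forall>b\<in>W. orthogonal b u" "\<forall>b\<in>W. orthogonal b v" "rotates_plane R t u v"
    by (rule balanced_frame_extend[OF R W(1) less1])
  let ?B = "insert u (insert v W)"
  note B = balanced_frame_insert_pair[OF oR W(1) 1(3-8)]
  have less2: "card ?B < CARD('n)" using cW B(2) by simp
  obtain u' v' t' where 2: "0 \<le> t'" "t' \<le> pi" "norm u' = 1" "norm v' = 1" "orthogonal u' v'"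
      "\<forall>b\<in>?B. orthogonal b u'" "\<forall>b\<in>?B. orthogonal b v'" "rotates_plane R t' u' v'"
    by (rule balanced_frame_extend[OF R B(1) less2])
  note C = balanced_frame_insert_pair[OF oR B(1) 2(3-8)]
  have eq: "insert u' (insert v' ?B) = {u, v, u', v'} \<union> W" by blast
  have "pairwise orthogonal ({u, v, u', v'} \<union> W)" "\<forall>b\<in>{u, v, u', v'} \<union> W. norm b = 1"
    using C(1) unfolding balanced_frame_def eq by simp_all
  moreover have "card ({u, v, u', v'} \<union> W) = CARD('n)"
    using C(2) B(2) cW unfolding eq by simp
  ultimately have form: "two_plane_form R W u v t u' v' t'"
    using cW W(3) 1 2 unfolding two_plane_form_def by simp
  show thesis
  proof (cases "t \<le> t'")
    case True
    then show thesis using that form by blast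
  next
    case False
    then show thesis using that[OF two_plane_form_swap[OF form]] by simp
  qed
qed

lemma matrix_eq_on_span:
  fixes A C :: "real^'n^'n"
  assumes "span B = UNIV" "\<And>b. b \<in> B \<Longrightarrow> A *v b = C *v b"
  shows "A = C"
  unfolding matrix_eq
proof
  fix x
  show "A *v x = C *v x"
    by (rule linear_eq_on_span[of "(*v) A" "(*v) C" B]) (use assms in auto)
qed

text \<open>Expanding the standard basis vectors in \<open>B\<close> gives the completeness relation
\<open>\<Sum>b\<in>B. b\<^sub>i b\<^sub>j = \<delta>\<^sub>i\<^sub>j\<close>, which turns the sum over \<open>B\<close> into the sum of the diagonal entries.\<close>

lemma trace_orthonormal:
  fixes M :: "real^'n^'n"
  assumes B: "pairwise orthogonal B" "\<And>b. b \<in> B \<Longrightarrow> norm b = 1" "span B = UNIV"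
  shows "trace M = (\<Sum>b\<in>B. b \<bullet> (M *v b))"
proof -
  have fB: "finite B" using orthonormal_independent B by blast
  have d: "(\<Sum>b\<in>B. b $ i * b $ j) = (if i = j then 1 else 0)" for i j
  proof -
    have "(\<Sum>b\<in>B. (axis j 1 \<bullet> b) *\<^sub>R b) = axis j 1"
      by (rule orthonormal_basis_expand) (use B fB in auto)
    then have "(\<Sum>b\<in>B. (axis j 1 \<bullet> b) *\<^sub>R b) $ i = axis j (1::real) $ i" by (rule arg_cong)
    moreover have "(\<Sum>b\<in>B. (axis j 1 \<bullet> b) *\<^sub>R b) $ i = (\<Sum>b\<in>B. b $ i * b $ j)"
      by (simp add: sum_component inner_axis' mult.commute)
    ultimately show ?thesis by (simp add: axis_def)
  qed
  have "(\<Sum>b\<in>B. b \<bullet> (M *v b)) = (\<Sum>b\<in>B. \<Sum>i\<in>UNIV. \<Sum>j\<in>UNIV. M $ i $ j * (b $ i * b $ j))"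
    by (simp add: inner_vec_def matrix_vector_mult_def sum_distrib_left mult_ac)
  also have "\<dots> = (\<Sum>i\<in>UNIV. \<Sum>b\<in>B. \<Sum>j\<in>UNIV. M $ i $ j * (b $ i * b $ j))"
    by (rule sum.swap)
  also have "\<dots> = (\<Sum>i\<in>UNIV. \<Sum>j\<in>UNIV. \<Sum>b\<in>B. M $ i $ j * (b $ i * b $ j))"
    by (intro sum.cong refl sum.swap)
  also have "\<dots> = (\<Sum>i\<in>UNIV. \<Sum>j\<in>UNIV. if i = j then M $ i $ j else 0)"
    unfolding sum_distrib_left[symmetric] d by (intro sum.cong refl) simp
  also have "\<dots> = trace M" by (simp add: trace_def)
  finally show ?thesis by simp
qed

section \<open>Exponential and skew parts on a rotated plane\<close>

text \<open>On the plane of \<open>u\<close> and \<open>v\<close> the powers of \<open>F\<close> cycle through the four directions, so the terms of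
the exponential series are those of the cosine and sine series.\<close>

lemma mat_exp_rotates_plane:
  fixes F :: "real^'n^'n"
  assumes Fu: "F *v u = t *\<^sub>R v" and Fv: "F *v v = - (t *\<^sub>R u)"
  shows "rotates_plane (mat_exp F) t u v"
proof -
  have half: "mat_exp F *v x = cos t *\<^sub>R x + sin t *\<^sub>R y"
    if x: "F *v x = t *\<^sub>R y" and y: "F *v y = - (t *\<^sub>R x)" for x y
  proof -
    have power: "((1 / fact k) *\<^sub>R mat_pow F k) *v x = (cos_coeff k *\<^sub>R t ^ k) *\<^sub>R x + (sin_coeff k *\<^sub>R t ^ k) *\<^sub>R y" for k
    proof (induction k)
      case 0
      show ?case by simp
    next
      case (Suc k)
      have "((1 / fact (Suc k)) *\<^sub>R mat_pow F (Suc k)) *v x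
          = (1 / real (Suc k)) *\<^sub>R (F *v (((1 / fact k) *\<^sub>R mat_pow F k) *v x))"
        by (simp add: scaleR_matrix_vector_assoc[symmetric] matrix_vector_mult_scaleR matrix_vector_mul_assoc[symmetric])
      also have "\<dots> = (1 / real (Suc k)) *\<^sub>R ((cos_coeff k * t ^ k * t) *\<^sub>R y - (sin_coeff k * t ^ k * t) *\<^sub>R x)"
        unfolding Suc.IH by (simp add: matrix_vector_right_distrib matrix_vector_mult_scaleR x y)
      also have "\<dots> = (cos_coeff (Suc k) *\<^sub>R t ^ Suc k) *\<^sub>R x + (sin_coeff (Suc k) *\<^sub>R t ^ Suc k) *\<^sub>R y"
        by (simp add: cos_coeff_Suc sin_coeff_Suc scaleR_diff_right mult_ac)
      finally show ?case .
    qed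
    have "linear (\<lambda>A :: real^'n^'n. A *v x)"
      by (rule linearI) (simp_all add: matrix_vector_mult_add_rdistrib scaleR_matrix_vector_assoc)
    then have bl: "bounded_linear (\<lambda>A :: real^'n^'n. A *v x)" by (simp add: linear_conv_bounded_linear)
    have "(\<lambda>k. ((1 / fact k) *\<^sub>R mat_pow F k) *v x) sums (mat_exp F *v x)"
      by (rule bounded_linear.sums[OF bl mat_exp_sums])
    moreover have "(\<lambda>k. ((1 / fact k) *\<^sub>R mat_pow F k) *v x) sums (cos t *\<^sub>R x + sin t *\<^sub>R y)"
      unfolding power by (intro sums_add bounded_linear.sums[OF bounded_linear_scaleR_left] cos_converges sin_converges)
    ultimately show ?thesis by (rule sums_unique2)
  qed
  have neg: "F *v (- u) = - (t *\<^sub>R v)" using Fu matrix_vector_mult_scaleR[of F "-1" u] by simp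
  show ?thesis
    \<comment> \<open>the pair \<open>(v, - u)\<close> satisfies the same relations as \<open>(u, v)\<close>\<close>
    using half[OF Fu Fv] half[of v "- u"] Fv neg by (simp add: rotates_plane_def)
qed

lemma rotates_plane_square:
  assumes "rotates_plane R t u v"
  shows "rotates_plane (R ** R) (2 * t) u v"
proof -
  have 1: "R *v u = cos t *\<^sub>R u + sin t *\<^sub>R v" "R *v v = cos t *\<^sub>R v - sin t *\<^sub>R u"
    using assms by (auto simp only: rotates_plane_def)
  have "R *v (R *v u) = (cos t * cos t - sin t * sin t) *\<^sub>R u + (2 * sin t * cos t) *\<^sub>R v"
    unfolding 1 matrix_vector_right_distrib matrix_vector_mult_scaleR scaleR_add_right scaleR_diff_right
    unfolding scaleR_diff_left mult_2 distrib_right scaleR_add_left by (simp add: mult.commute)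
  moreover have "R *v (R *v v) = (cos t * cos t - sin t * sin t) *\<^sub>R v - (2 * sin t * cos t) *\<^sub>R u"
    unfolding 1 matrix_vector_mult_diff_distrib matrix_vector_mult_scaleR scaleR_add_right scaleR_diff_right
    unfolding scaleR_diff_left mult_2 distrib_right scaleR_add_left by (simp add: mult.commute)
  ultimately show ?thesis
    by (simp only: rotates_plane_def matrix_vector_mul_assoc[symmetric] cos_double sin_double power2_eq_square)
qed

text \<open>On a plane rotated by \<open>t\<close>, the matrices \<open>R - R\<^sup>T\<close> and \<open>(R\<^sup>2 - (R\<^sup>2)\<^sup>T) / 2\<close> are the multiples
\<open>2 sin t\<close> and \<open>2 sin t cos t\<close> of the quarter turn. Their combination with weight \<open>y\<close> therefore
vanishes on this plane exactly when \<open>y = cos t\<close> or \<open>sin t = 0\<close>, which is how \<open>f\<^sub>\<plusminus>\<close> is separated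
from the other plane.\<close>

lemma rotates_plane_skew_part:
  fixes R :: "real^'n^'n"
  assumes R: "orthogonal_matrix R" and rot: "rotates_plane R t u v"
  shows "(y *\<^sub>R (R - transpose R) - (1/2) *\<^sub>R (R ** R - transpose (R ** R))) *v u
          = (2 * sin t * (y - cos t)) *\<^sub>R v"
    and "(y *\<^sub>R (R - transpose R) - (1/2) *\<^sub>R (R ** R - transpose (R ** R))) *v v
          = - ((2 * sin t * (y - cos t)) *\<^sub>R u)"
    and "(R - transpose R) *v u = (2 * sin t) *\<^sub>R v"
    and "(R - transpose R) *v v = - ((2 * sin t) *\<^sub>R u)"
proof -
  have skew: "(M - transpose M) *v u = (2 * sin s) *\<^sub>R v" "(M - transpose M) *v v = - ((2 * sin s) *\<^sub>R u)"
    if M: "orthogonal_matrix M" and r: "rotates_plane M s u v" for M s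
    using r unfolding matrix_vector_mult_diff_rdistrib rotates_plane_transpose[OF M r] rotates_plane_def mult_2 scaleR_add_left
    by (elim conjE, simp only:, simp)+
  note 1 = skew[OF R rot] and 2 = skew[OF orthogonal_matrix_mul[OF R R] rotates_plane_square[OF rot]]
  show "(R - transpose R) *v u = (2 * sin t) *\<^sub>R v" "(R - transpose R) *v v = - ((2 * sin t) *\<^sub>R u)"
    by (fact 1)+
  have c: "y * (2 * sin t) - 1/2 * (2 * sin (2 * t)) = 2 * sin t * (y - cos t)"
    unfolding sin_double by (simp add: algebra_simps)
  show "(y *\<^sub>R (R - transpose R) - (1/2) *\<^sub>R (R ** R - transpose (R ** R))) *v u
          = (2 * sin t * (y - cos t)) *\<^sub>R v"
    unfolding matrix_vector_mult_diff_rdistrib[of "y *\<^sub>R _"] scaleR_matrix_vector_assoc[symmetric] 1 2 c[symmetric]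
    by (simp only: scaleR_diff_left scaleR_scaleR)
  show "(y *\<^sub>R (R - transpose R) - (1/2) *\<^sub>R (R ** R - transpose (R ** R))) *v v
          = - ((2 * sin t * (y - cos t)) *\<^sub>R u)"
    unfolding matrix_vector_mult_diff_rdistrib[of "y *\<^sub>R _"] scaleR_matrix_vector_assoc[symmetric] 1 2 c[symmetric]
    by (simp add: scaleR_diff_left)
qed

section \<open>Wedge products and antisymmetric matrices\<close>

lemma wedge_mult_vec: "wedge a b *v x = (b \<bullet> x) *\<^sub>R a - (a \<bullet> x) *\<^sub>R b"
  by (simp add: wedge_def matrix_vector_mult_diff_rdistrib outer_mult_vec)

lemma orthogonal_decomposition_wedge_pair:
  fixes a b c d :: "real^'n"
  assumes "wedge a b \<noteq> 0" "wedge c d \<noteq> 0" and o: "\<And>x y. x \<in> {a, b} \<Longrightarrow> y \<in> {c, d} \<Longrightarrow> orthogonal x y"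
  shows "orthogonal_decomposition (wedge a b + wedge c d) [wedge a b, wedge c d]"
proof -
  have "orthogonal p q" if p: "p \<in> span {a, b}" and q: "q \<in> span {c, d}" for p q
  proof -
    have "orthogonal x q" if "x \<in> {a, b}" for x
      by (rule orthogonal_to_span[OF q]) (use o that in blast)
    then have "orthogonal q p"
      by (intro orthogonal_to_span[OF p]) (simp add: orthogonal_commute)
    then show ?thesis by (simp add: orthogonal_commute)
  qed
  then show ?thesis
    unfolding orthogonal_decomposition_def two_plane_of_def using assms(1,2)
    by (intro conjI exI[of _ "[span {a, b}, span {c, d}]"]) auto
qed

section \<open>Matrices in the adapted basis\<close>

lemma two_plane_form_distinct:
  assumes form: "two_plane_form R W u v t u' v' t'"
  shows "distinct [u, v, u', v']" "finite W" "{u, v, u', v'} \<inter> W = {}"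
proof -
  let ?S = "set [u, v, u', v']"
  have fin: "finite (?S \<union> W)"
    by (rule card_ge_0_finite) (use form in \<open>simp add: two_plane_form_def\<close>)
  then show fW: "finite W" by simp
  have "card (?S \<union> W) = card W + 4"
    using form unfolding two_plane_form_def by simp
  moreover have "card ?S + card W = card (?S \<union> W) + card (?S \<inter> W)"
    by (rule card_Un_Int) (use fW in auto)
  moreover have "card ?S \<le> 4" using card_length[of "[u, v, u', v']"] by simp
  ultimately have c: "card ?S = 4" "card (?S \<inter> W) = 0" by linarith+
  then show "distinct [u, v, u', v']" by (intro card_distinct) simp
  show "{u, v, u', v'} \<inter> W = {}" using c(2) fW by simp
qed

lemma two_plane_form_orthonormal:
  assumes form: "two_plane_form R W u v t u' v' t'"
  shows "u \<bullet> u = 1" "v \<bullet> v = 1" "u' \<bullet> u' = 1" "v' \<bullet> v' = 1"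
    and "u \<bullet> v = 0" "u \<bullet> u' = 0" "u \<bullet> v' = 0" "v \<bullet> u' = 0" "v \<bullet> v' = 0" "u' \<bullet> v' = 0"
    and "v \<bullet> u = 0" "u' \<bullet> u = 0" "v' \<bullet> u = 0" "u' \<bullet> v = 0" "v' \<bullet> v = 0" "v' \<bullet> u' = 0"
    and "\<And>w. w \<in> W \<Longrightarrow> w \<bullet> w = 1"
    and "\<And>w. w \<in> W \<Longrightarrow> u \<bullet> w = 0 \<and> v \<bullet> w = 0 \<and> u' \<bullet> w = 0 \<and> v' \<bullet> w = 0"
    and "span ({u, v, u', v'} \<union> W) = UNIV"
proof -
  have n: "\<And>b. b \<in> {u, v, u', v'} \<union> W \<Longrightarrow> norm b = 1"
    and p: "pairwise orthogonal ({u, v, u', v'} \<union> W)"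
    and c: "card ({u, v, u', v'} \<union> W) = CARD('a)"
    using form unfolding two_plane_form_def by blast+
  note d = two_plane_form_distinct[OF form]
  have o: "x \<bullet> y = 0" if "x \<in> {u, v, u', v'} \<union> W" "y \<in> {u, v, u', v'} \<union> W" "x \<noteq> y" for x y
    using pairwiseD[OF p that] by (simp add: orthogonal_def)
  have n1: "b \<bullet> b = 1" if "b \<in> {u, v, u', v'} \<union> W" for b using n[OF that] by (simp add: norm_eq_1)
  show "u \<bullet> u = 1" "v \<bullet> v = 1" "u' \<bullet> u' = 1" "v' \<bullet> v' = 1" "\<And>w. w \<in> W \<Longrightarrow> w \<bullet> w = 1"
    by (rule n1; blast)+
  show "u \<bullet> v = 0" "u \<bullet> u' = 0" "u \<bullet> v' = 0" "v \<bullet> u' = 0" "v \<bullet> v' = 0" "u' \<bullet> v' = 0"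
    "v \<bullet> u = 0" "u' \<bullet> u = 0" "v' \<bullet> u = 0" "u' \<bullet> v = 0" "v' \<bullet> v = 0" "v' \<bullet> u' = 0"
    by (rule o; use d(1) in auto)+
  show "u \<bullet> w = 0 \<and> v \<bullet> w = 0 \<and> u' \<bullet> w = 0 \<and> v' \<bullet> w = 0" if "w \<in> W" for w
    using that d(3) by (intro conjI o) auto
  show "span ({u, v, u', v'} \<union> W) = UNIV" by (rule orthonormal_card_span[OF p n c])
qed

lemma two_plane_form_matrix_eqI:
  fixes A C :: "real^'n^'n"
  assumes form: "two_plane_form R W u v t u' v' t'"
    and "A *v u = C *v u" "A *v v = C *v v" "A *v u' = C *v u'" "A *v v' = C *v v'"
    and "\<And>w. w \<in> W \<Longrightarrow> A *v w = C *v w"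
  shows "A = C"
  by (rule matrix_eq_on_span[OF two_plane_form_orthonormal(19)[OF form]]) (use assms in blast)

lemma two_plane_form_trace:
  fixes M R :: "real^'n^'n"
  assumes form: "two_plane_form R W u v t u' v' t'"
    and M: "rotates_plane M s u v" "rotates_plane M s' u' v'" "\<And>w. w \<in> W \<Longrightarrow> M *v w = w"
  shows "trace M = 2 * cos s + 2 * cos s' + (real CARD('n) - 4)"
proof -
  note d = two_plane_form_distinct[OF form] and o = two_plane_form_orthonormal[OF form]
  have cW: "real (card W) = real CARD('n) - 4"
    using form unfolding two_plane_form_def by linarith
  have "trace M = (\<Sum>b\<in>{u, v, u', v'} \<union> W. b \<bullet> (M *v b))"
    using trace_orthonormal[OF _ _ o(19)] form unfolding two_plane_form_def by blast
  also have "\<dots> = (\<Sum>b\<in>{u, v, u', v'}. b \<bullet> (M *v b)) + (\<Sum>b\<in>W. b \<bullet> (M *v b))"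
    by (rule sum.union_disjoint) (use d in auto)
  also have "(\<Sum>b\<in>W. b \<bullet> (M *v b)) = (\<Sum>b\<in>W. 1)"
    by (rule sum.cong) (simp_all add: M(3) o(17))
  also have "(\<Sum>b\<in>{u, v, u', v'}. b \<bullet> (M *v b))
      = u \<bullet> (M *v u) + v \<bullet> (M *v v) + u' \<bullet> (M *v u') + v' \<bullet> (M *v v')"
    using d(1) by (simp add: add.assoc)
  also have "\<dots> = 2 * cos s + 2 * cos s'"
    using M(1,2) by (simp add: rotates_plane_def inner_add_right inner_diff_right o(1-16))
  finally show ?thesis using cW by simp
qed

lemma antisymmetric_matrix_skew_part: "antisymmetric_matrix (c *\<^sub>R (M - transpose M))"
  by (simp add: antisymmetric_matrix_def transpose_def vec_eq_iff algebra_simps)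

lemma antisymmetric_matrix_wedge: "antisymmetric_matrix (wedge a b)"
proof -
  have o: "transpose (outer x y) = outer y x" for x y :: "real^'a"
    by (simp add: outer_def matrix_def transpose_def vec_eq_iff inner_axis)
  have "transpose (wedge a b) = transpose (outer a b) - transpose (outer b a)"
    by (simp add: wedge_def transpose_def vec_eq_iff)
  then show ?thesis by (simp add: antisymmetric_matrix_def o) (simp add: wedge_def)
qed

lemma antisymmetric_matrix_add:
  "antisymmetric_matrix A \<Longrightarrow> antisymmetric_matrix B \<Longrightarrow> antisymmetric_matrix (A + B)"
proof -
  have "transpose (A + B) = transpose A + transpose B" by (simp add: transpose_def vec_eq_iff)
  then show "antisymmetric_matrix A \<Longrightarrow> antisymmetric_matrix B \<Longrightarrow> ?thesis"
    by (simp add: antisymmetric_matrix_def)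
qed

text \<open>Both matrices rotate the two planes by the same angles and fix \<open>W\<close>.\<close>

lemma two_plane_form_mat_exp:
  fixes F R :: "real^'n^'n"
  assumes form: "two_plane_form R W u v t u' v' t'"
    and F: "F *v u = t *\<^sub>R v" "F *v v = - (t *\<^sub>R u)" "F *v u' = t' *\<^sub>R v'" "F *v v' = - (t' *\<^sub>R u')"
      "\<And>w. w \<in> W \<Longrightarrow> F *v w = 0"
  shows "mat_exp F = R"
proof (rule two_plane_form_matrix_eqI[OF form])
  have R: "rotates_plane R t u v" "rotates_plane R t' u' v'" "\<And>w. w \<in> W \<Longrightarrow> R *v w = w"
    using form unfolding two_plane_form_def by simp_all
  have E: "rotates_plane (mat_exp F) t u v" "rotates_plane (mat_exp F) t' u' v'"
    by (rule mat_exp_rotates_plane[OF F(1,2)], rule mat_exp_rotates_plane[OF F(3,4)])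
  show "mat_exp F *v u = R *v u" "mat_exp F *v v = R *v v"
    "mat_exp F *v u' = R *v u'" "mat_exp F *v v' = R *v v'"
    using R(1,2) E unfolding rotates_plane_def by simp_all
  show "mat_exp F *v w = R *v w" if "w \<in> W" for w
    using mat_exp_rotates_plane[of F w 0 0] F(5)[OF that] R(3)[OF that]
    by (simp add: rotates_plane_def)
qed

section \<open>The logarithm of a rotation\<close>

lemma sin_eq_0_iff_cos: "sin x = 0 \<longleftrightarrow> cos x \<in> {1, -1 :: real}"
proof -
  have "sin x = 0 \<longleftrightarrow> (sin x)\<^sup>2 = 0" by simp
  also have "\<dots> \<longleftrightarrow> (cos x)\<^sup>2 = 1" unfolding sin_squared_eq by auto
  finally have "sin x = 0 \<longleftrightarrow> (cos x)\<^sup>2 = 1" .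
  then show ?thesis by (simp add: power2_eq_1_iff)
qed

theorem theorem5p2:
  fixes R f\<^sub>p f\<^sub>m :: "real^'n^'n"
    and n :: nat
    and \<delta> y\<^sub>p y\<^sub>m \<theta>\<^sub>p \<theta>\<^sub>m :: real
  assumes "CARD('n) = n" and "n \<in> {4, 5}"
    and "rotation_matrix R"
    and "\<delta> = 1/2 * trace (R ** R) - 1/4 * (trace R)\<^sup>2
             + 1/2 * (real n - 4) * trace R - 1/4 * real n * (real n - 6)"
    and "y\<^sub>p = 1/4 * (trace R - real n + 4) + 1/2 * sqrt \<delta>"
    and "y\<^sub>m = 1/4 * (trace R - real n + 4) - 1/2 * sqrt \<delta>"
    and "\<theta>\<^sub>p = arccos y\<^sub>p"
    and "\<theta>\<^sub>m = arccos y\<^sub>m"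
    and "f\<^sub>p = - (\<theta>\<^sub>p / (2 * sin \<theta>\<^sub>p * sqrt \<delta>)) *\<^sub>R
               (y\<^sub>m *\<^sub>R (R - transpose R) - (1/2) *\<^sub>R (R ** R - transpose (R ** R)))"
    and "f\<^sub>m = (\<theta>\<^sub>m / (2 * sin \<theta>\<^sub>m * sqrt \<delta>)) *\<^sub>R
               (y\<^sub>p *\<^sub>R (R - transpose R) - (1/2) *\<^sub>R (R ** R - transpose (R ** R)))"
  shows "\<delta> \<ge> 0 \<and> y\<^sub>p \<in> {-1..1} \<and> y\<^sub>m \<in> {-1..1} \<and>
    \<theta>\<^sub>p \<in> {0..pi} \<and> \<theta>\<^sub>m \<in> {0..pi} \<and>
    (\<delta> \<noteq> 0 \<and> y\<^sub>p \<notin> {1, -1} \<and> y\<^sub>m \<notin> {1, -1} \<longrightarrow>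
      (let f = f\<^sub>p + f\<^sub>m in
         mat_exp f = R \<and> antisymmetric_matrix f \<and> orthogonal_decomposition f [f\<^sub>p, f\<^sub>m])) \<and>
    (\<delta> = 0 \<and> y\<^sub>p \<notin> {1, -1} \<longrightarrow>
      (let f = (\<theta>\<^sub>p / (2 * sin \<theta>\<^sub>p)) *\<^sub>R (R - transpose R) in
         mat_exp f = R \<and> antisymmetric_matrix f))"
proof -
  have oR: "orthogonal_matrix R" using assms(3) by (simp add: rotation_matrix_def)
  obtain W u v t u' v' t' where form: "two_plane_form R W u v t u' v' t'" and le: "t \<le> t'"
    using rotation_two_plane_form[OF assms(3)] assms(1,2) by blast
  have t: "0 \<le> t" "t \<le> pi" "0 \<le> t'" "t' \<le> pi"
    and rot: "rotates_plane R t u v" "rotates_plane R t' u' v'"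
    and fix1: "\<And>w. w \<in> W \<Longrightarrow> R *v w = w"
    using form unfolding two_plane_form_def by simp_all
  note on = two_plane_form_orthonormal[OF form]
  have fix2: "\<And>w. w \<in> W \<Longrightarrow> (R ** R) *v w = w"
    by (simp add: matrix_vector_mul_assoc[symmetric] fix1)
  have tr1: "trace R = 2 * cos t + 2 * cos t' + (real n - 4)"
    using two_plane_form_trace[OF form rot fix1] assms(1) by simp
  have tr2: "trace (R ** R) = 2 * (2 * (cos t)\<^sup>2 - 1) + 2 * (2 * (cos t')\<^sup>2 - 1) + (real n - 4)"
    using two_plane_form_trace[OF form rot[THEN rotates_plane_square] fix2] assms(1)
    by (simp add: cos_double_cos)
  \<comment> \<open>the terms linear in the cosines and the constants cancel\<close>
  have delta: "\<delta> = (cos t - cos t')\<^sup>2"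
    unfolding assms(4) tr1 tr2 by (simp add: field_simps power2_eq_square)
  have "cos t' \<le> cos t" using le t by (simp add: cos_monotone_0_pi_le)
  then have sd: "sqrt \<delta> = cos t - cos t'" by (simp add: delta)
  have yp: "y\<^sub>p = cos t" and ym: "y\<^sub>m = cos t'"
    unfolding assms(5,6) sd tr1 by (simp_all add: field_simps)
  have tp: "\<theta>\<^sub>p = t" and tm: "\<theta>\<^sub>m = t'"
    using t by (simp_all add: assms(7,8) yp ym arccos_cos)
  note skew = rotates_plane_skew_part[OF oR rot(1)] and skew' = rotates_plane_skew_part[OF oR rot(2)]
  have rotW: "rotates_plane R 0 w 0" if "w \<in> W" for w
    using fix1[OF that] by (simp add: rotates_plane_def)
  note skewW = rotates_plane_skew_part[OF oR rotW]
  have generic: "mat_exp (f\<^sub>p + f\<^sub>m) = R \<and> antisymmetric_matrix (f\<^sub>p + f\<^sub>m) \<and>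
      orthogonal_decomposition (f\<^sub>p + f\<^sub>m) [f\<^sub>p, f\<^sub>m]"
    if d0: "\<delta> \<noteq> 0" and y: "y\<^sub>p \<notin> {1, -1}" "y\<^sub>m \<notin> {1, -1}"
  proof -
    have s: "sin t \<noteq> 0" "sin t' \<noteq> 0" using y by (simp_all only: sin_eq_0_iff_cos yp ym not_False_eq_True)
    have c: "cos t - cos t' \<noteq> 0" using d0 by (simp add: delta)
    have t0: "t \<noteq> 0" "t' \<noteq> 0" using s by auto
    \<comment> \<open>on its own plane each \<open>f\<^sub>\<plusminus>\<close> is the quarter turn scaled by the angle\<close>
    have ap: "- (t / (2 * sin t * (cos t - cos t'))) * (2 * sin t * (cos t' - cos t)) = t"
      using s c by (simp add: divide_simps) (simp add: algebra_simps)
    have am: "t' / (2 * sin t' * (cos t - cos t')) * (2 * sin t' * (cos t - cos t')) = t'"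
      using s c by simp
    have fp: "f\<^sub>p *v u = t *\<^sub>R v" "f\<^sub>p *v v = - (t *\<^sub>R u)" "f\<^sub>p *v u' = 0" "f\<^sub>p *v v' = 0"
      "\<And>w. w \<in> W \<Longrightarrow> f\<^sub>p *v w = 0"
      unfolding assms(9) tp sd ym scaleR_matrix_vector_assoc[symmetric] skew skew' scaleR_minus_right scaleR_scaleR ap
      by (simp_all add: skewW(1))
    have fm: "f\<^sub>m *v u = 0" "f\<^sub>m *v v = 0" "f\<^sub>m *v u' = t' *\<^sub>R v'" "f\<^sub>m *v v' = - (t' *\<^sub>R u')"
      "\<And>w. w \<in> W \<Longrightarrow> f\<^sub>m *v w = 0"
      unfolding assms(10) tm sd yp scaleR_matrix_vector_assoc[symmetric] skew skew' scaleR_minus_right scaleR_scaleR am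
      by (simp_all add: skewW(1))
    have wp: "f\<^sub>p = wedge (t *\<^sub>R v) u"
      by (rule two_plane_form_matrix_eqI[OF form])
        (simp_all add: fp wedge_mult_vec on)
    have wm: "f\<^sub>m = wedge (t' *\<^sub>R v') u'"
      by (rule two_plane_form_matrix_eqI[OF form])
        (simp_all add: fm wedge_mult_vec on)
    have "v \<noteq> 0" "v' \<noteq> 0" using on by auto
    then have "f\<^sub>p \<noteq> 0" "f\<^sub>m \<noteq> 0" using fp(1) fm(3) t0 by auto
    then have "orthogonal_decomposition (f\<^sub>p + f\<^sub>m) [f\<^sub>p, f\<^sub>m]"
      unfolding wp wm by (rule orthogonal_decomposition_wedge_pair) (auto simp: orthogonal_def on)
    moreover have "antisymmetric_matrix (f\<^sub>p + f\<^sub>m)"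
      unfolding wp wm by (intro antisymmetric_matrix_add antisymmetric_matrix_wedge)
    moreover have "mat_exp (f\<^sub>p + f\<^sub>m) = R"
      by (rule two_plane_form_mat_exp[OF form]) (simp_all add: matrix_vector_mult_add_rdistrib fp fm)
    ultimately show ?thesis by blast
  qed
  have isoclinic: "mat_exp ((\<theta>\<^sub>p / (2 * sin \<theta>\<^sub>p)) *\<^sub>R (R - transpose R)) = R"
    if d0: "\<delta> = 0" and y: "y\<^sub>p \<notin> {1, -1}"
  proof -
    have "cos t = cos t'" using d0 by (simp add: delta)
    then have tt: "t' = t" using t cos_inj_pi by metis
    have "sin t \<noteq> 0" using y by (simp only: sin_eq_0_iff_cos yp not_False_eq_True)
    then have a: "t / (2 * sin t) * (2 * sin t) = t" by simp
    show ?thesis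
      by (rule two_plane_form_mat_exp[OF form])
        (simp_all only: tp tt scaleR_matrix_vector_assoc[symmetric] skew skew'[unfolded tt] skewW(3)
          scaleR_minus_right scaleR_scaleR a scaleR_zero_right)
  qed
  show ?thesis
    using generic isoclinic t yp ym tp tm
    by (simp add: Let_def delta antisymmetric_matrix_skew_part)
qed

end
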